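(* Let $p$ be a prime, $q=p^f$ with $f\ge1$, let $k\mid q-1$, and let $A_k=\{x^k:x\in\mathbb{F}_q^\times\}<\mathbb{F}_q^\times$ satisfy $\mathbb{F}_p(A_k)=\mathbb{F}_q$, with $k\ge3$ and $t=|A_k|=(q-1)/k\ge5$. Then, for every $d\in\mathbb{F}_q$ with $d\ne0$, $$r_{A_k-A_k}(d)<\frac t2.$$
   Context: For $A\subseteq\mathbb{F}_q$ and $d\in\mathbb{F}_q$, $r_{A-A}(d)=\#\{(x,y)\in A^2: x-y=d\}=|A\cap(A-d)|$. $\mathbb{F}_p(A_k)$ denotes the smallest subfield of $\mathbb{F}_q$ containing $A_k$. $A_k$ is the unique subgroup of index $k$ in $\mathbb{F}_q^\times$. *)

theory Defs
  imports
    "HOL-Computational_Algebra.Computational_Algebra"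
    "HOL-Library.Cardinality"
begin

text \<open>The clause for \<open>inverse\<close> needs no side condition, since \<open>inverse 0 = 0\<close> in class \<open>field\<close>.\<close>

definition is_subfield :: "'a::field set \<Rightarrow> bool" where
  "is_subfield K \<longleftrightarrow> 0 \<in> K \<and> 1 \<in> K \<and>
     (\<forall>x\<in>K. \<forall>y\<in>K. x - y \<in> K) \<and>
     (\<forall>x\<in>K. \<forall>y\<in>K. x * y \<in> K) \<and>
     (\<forall>x\<in>K. inverse x \<in> K)"

definition generated_subfield :: "'a::field set \<Rightarrow> 'a set" where
  "generated_subfield S = \<Inter>{K. is_subfield K \<and> S \<subseteq> K}"

definition power_subgroup :: "nat \<Rightarrow> 'a::field set" where
  "power_subgroup k = {x ^ k | x. x \<noteq> 0}"

definition diff_rep :: "'a::ab_group_add set \<Rightarrow> 'a \<Rightarrow> nat" where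
  "diff_rep A d = card {(x, y) \<in> A \<times> A. x - y = d}"

lemma is_subfield_generated_subfield: "is_subfield (generated_subfield S)"
  unfolding generated_subfield_def is_subfield_def by blast

lemma subset_generated_subfield: "S \<subseteq> generated_subfield S"
  unfolding generated_subfield_def by blast

lemma generated_subfield_least:
  "is_subfield K \<Longrightarrow> S \<subseteq> K \<Longrightarrow> generated_subfield S \<subseteq> K"
  unfolding generated_subfield_def by blast

lemma diff_rep_eq_card_Int:
  "diff_rep A d = card (A \<inter> (\<lambda>a. a - d) ` A)"
proof -
  have "bij_betw snd {(x, y) \<in> A \<times> A. x - y = d} (A \<inter> (\<lambda>a. a - d) ` A)"
  proof (rule bij_betw_byWitness[where f' = "\<lambda>y. (y + d, y)"])
  qed (auto simp: algebra_simps image_iff)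
  then show ?thesis
    unfolding diff_rep_def by (rule bij_betw_same_card)
qed

lemma power_card_minus_one:
  fixes x :: "'a::finite_field"
  assumes "x \<noteq> 0"
  shows "x ^ (CARD('a) - 1) = 1"
proof -
  have "x * x ^ (CARD('a) - 1) = x ^ CARD('a)"
    by (simp add: power_eq_if)
  also have "\<dots> = x" by (rule finite_field_power_card_eq_same)
  finally show ?thesis using assms by simp
qed

lemma card_power_eq_le:
  fixes a :: "'a::field"
  assumes "n > 0"
  shows "finite {x. x ^ n = a}" "card {x. x ^ n = a} \<le> n"
proof -
  let ?p = "monom 1 n - [:a:]"
  have "coeff ?p n = 1"
    using assms by (simp add: coeff_pCons split: nat.split)
  then have nz: "?p \<noteq> 0" by (metis coeff_0 zero_neq_one)
  have eq: "{x. x ^ n = a} = {x. poly ?p x = 0}"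
    by (auto simp: poly_monom)
  show "finite {x. x ^ n = a}"
    unfolding eq by (rule poly_roots_finite[OF nz])
  have "degree ?p \<le> n"
    by (intro degree_diff_le) (auto simp: degree_monom_eq)
  moreover have "card {x. poly ?p x = 0} \<le> degree ?p"
    using card_poly_roots_bound[OF nz] .
  ultimately show "card {x. x ^ n = a} \<le> n"
    unfolding eq by linarith
qed

lemma card_power_subgroup:
  fixes k :: nat
  assumes "k dvd CARD('a::finite_field) - 1"
  shows "card (power_subgroup k :: 'a set) = (CARD('a) - 1) div k"
proof -
  have "card {0, 1::'a} \<le> CARD('a)" by (rule card_mono) auto
  then have q: "CARD('a) - 1 > 0" by simp
  obtain m where m: "CARD('a) - 1 = k * m" using assms by blast
  from q have "k * m > 0" unfolding m .
  then have pos: "k > 0" "m > 0" by simp_all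
  let ?A = "power_subgroup k :: 'a set"
  have "(x ^ k) ^ m = 1" if "x \<noteq> 0" for x :: 'a
    using power_card_minus_one[OF that] unfolding m power_mult .
  then have "?A \<subseteq> {x. x ^ m = 1}"
    unfolding power_subgroup_def by blast
  then have "card ?A \<le> card {x::'a. x ^ m = 1}"
    by (intro card_mono card_power_eq_le) (use pos in auto)
  also have "\<dots> \<le> m" using pos by (intro card_power_eq_le)
  finally have le: "card ?A \<le> m" .
  have "UNIV - {0} = (\<Union>a\<in>?A. {x. x ^ k = a})"
    unfolding power_subgroup_def using pos by (auto simp: power_0_left)
  then have "CARD('a) - 1 = card (\<Union>a\<in>?A. {x. x ^ k = a})"
    by (metis card_Diff_singleton UNIV_I)
  also have "\<dots> \<le> (\<Sum>a\<in>?A. card {x. x ^ k = a})"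
    by (intro card_UN_le) auto
  also have "\<dots> \<le> (\<Sum>a\<in>?A. k)"
    by (intro sum_mono card_power_eq_le pos)
  finally have "k * m \<le> k * card ?A"
    unfolding m by (simp add: mult.commute)
  with pos le have "card ?A = m" by simp
  then show ?thesis using m pos by simp
qed

end

theory Submission
  imports Defs
begin

text \<open>
  The representations of \<open>d\<close> correspond to the set \<open>B\<close> of common roots of \<open>X ^ t - c\<close> and
  \<open>(X + 1) ^ t - c\<close> with \<open>c = inverse d ^ t\<close>. Stepanov's method with the auxiliary polynomial
  \<open>Q = (X + 1) ^ (t + 1) - X ^ (t + 1) - c\<close>, which vanishes to order two on \<open>B\<close>, gives
  \<open>2 * card B \<le> t\<close> unless \<open>Q = 0\<close>.

  An identity \<open>(x + 1) ^ N = x ^ N + e\<close> for all \<open>x\<close> makes \<open>x \<mapsto> x ^ N\<close> a field endomorphism.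
  If \<open>N \<equiv> 1\<close> modulo \<open>t\<close>, it fixes the subgroup and hence the whole field, so \<open>q \<le> N\<close>.
  With \<open>N = t + 1\<close> this excludes \<open>Q = 0\<close>. In the case of equality \<open>2 * card B = t\<close> the same identity
  is derived for \<open>N = 2 * t + 1\<close>, which contradicts \<open>k \<ge> 3\<close>. Outside characteristic 3 it comes from
  differential equations for the square root of \<open>Q\<close> up to a constant; in characteristic 3, from
  polynomials of small degree that express an element of \<open>B\<close> in terms of its ninth power.
\<close>

section \<open>Power maps compatible with a shift by 1\<close>

lemma of_nat_CARD_eq_0: "of_nat CARD('a::finite_field) = (0 :: 'a)"
proof -
  have "(\<Sum>x\<in>(UNIV::'a set). x + 1) = (\<Sum>x\<in>(UNIV::'a set). x)"
    by (rule sum.reindex_bij_witness[of _ "\<lambda>x. x - 1" "\<lambda>x. x + 1"]) auto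
  then show ?thesis by (simp add: sum.distrib)
qed

text \<open>Scaling \<open>x / y\<close> by \<open>y ^ N\<close> turns the shift by 1 into
  additivity, so the fixed points of the power map form a subfield containing
  \<open>S\<close>.\<close>

lemma power_fixed_everywhere:
  fixes e :: "'a::field" and S :: "'a set"
  assumes N: "N > 0" and shift: "\<And>x::'a. (x + 1) ^ N = x ^ N + e"
    and gen: "generated_subfield S = UNIV" and fixed: "\<And>a. a \<in> S \<Longrightarrow> a ^ N = a"
  shows "x ^ N = (x::'a)"
proof -
  have e: "e = 1" using shift[of 0] N by (simp add: power_0_left)
  \<comment> \<open>Evaluation at -1 replaces a discussion of the parity of \<open>N\<close> and
    also covers characteristic 2.\<close>
  have minus: "(- 1) ^ N = (- 1 :: 'a)"
    using shift[of "-1"] N e by (simp add: power_0_left eq_neg_iff_add_eq_0)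
  have add: "(x + y) ^ N = x ^ N + y ^ N" for x y :: 'a
  proof (cases "y = 0")
    case True
    then show ?thesis using N by (simp add: power_0_left)
  next
    case False
    have "x + y = y * (x / y + 1)" using False by (simp add: field_simps)
    then have "(x + y) ^ N = y ^ N * (x / y) ^ N + y ^ N"
      using shift[of "x / y"] e by (metis power_mult_distrib distrib_left mult_1_right)
    then show ?thesis using False by (simp add: power_divide)
  qed
  have diff: "(x - y) ^ N = x ^ N - y ^ N" for x y :: 'a
    using add[of x "(- 1) * y"] unfolding power_mult_distrib minus by simp
  have "is_subfield {x::'a. x ^ N = x}"
    unfolding is_subfield_def using N
    by (auto simp: diff power_mult_distrib power_inverse power_0_left)
  moreover have "S \<subseteq> {x. x ^ N = x}" using fixed by blast
  ultimately have "generated_subfield S \<subseteq> {x. x ^ N = x}"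
    by (rule generated_subfield_least)
  then show ?thesis using gen by blast
qed

section \<open>Polynomials with prescribed simple roots\<close>

lemma prod_linear_dvd:
  fixes p :: "'a::field poly"
  assumes "finite B" and "\<And>b. b \<in> B \<Longrightarrow> poly p b = 0"
  shows "(\<Prod>b\<in>B. [:- b, 1:]) dvd p"
  using assms
proof (induction B arbitrary: p rule: finite_induct)
  case empty
  then show ?case by simp
next
  case (insert a B)
  then have "[:- a, 1:] dvd p" by (simp add: poly_eq_0_iff_dvd)
  then obtain r where r: "p = [:- a, 1:] * r" by blast
  have "poly r b = 0" if "b \<in> B" for b
    using insert.prems[of b] insert.hyps that r by auto
  then have "(\<Prod>b\<in>B. [:- b, 1:]) dvd r" by (rule insert.IH)
  then show ?case using insert.hyps r by (simp add: mult_dvd_mono del: mult_pCons_left)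
qed

lemma degree_prod_linear: "degree (\<Prod>b\<in>B. [:- b, 1::'a::field:]) = card B"
  by (subst degree_prod_eq_sum_degree) auto

lemma poly_prod_linear_eq_0:
  "finite B \<Longrightarrow> poly (\<Prod>b\<in>B. [:- b, 1::'a::field:]) x = 0 \<longleftrightarrow> x \<in> B"
  by (auto simp: poly_prod)

lemma poly_pderiv_prod_linear_neq_0:
  fixes B :: "'a::field set"
  assumes "finite B" "b \<in> B"
  shows "poly (pderiv (\<Prod>b\<in>B. [:- b, 1:])) b \<noteq> 0"
proof -
  have "(\<Prod>b\<in>B. [:- b, 1:]) = [:- b, 1:] * (\<Prod>b\<in>B - {b}. [:- b, 1:])"
    using assms by (rule prod.remove)
  then have "poly (pderiv (\<Prod>b\<in>B. [:- b, 1:])) b = poly (\<Prod>b\<in>B - {b}. [:- b, 1:]) b"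
    by (simp add: pderiv_mult pderiv_pCons del: mult_pCons_left)
  then show ?thesis using poly_prod_linear_eq_0[of "B - {b}" b] assms by auto
qed

text \<open>The roots of the product are simple, so its derivative has no zero in \<open>B\<close>
  and can be cancelled. This supplies the assumption \<open>cancel\<close> of
  \<open>shift_identity_of_square\<close>.\<close>

lemma prod_linear_dvd_mult_pderiv:
  fixes B :: "'a::field set"
  assumes fin: "finite B"
    and dvd: "(\<Prod>b\<in>B. [:- b, 1:]) dvd g * pderiv (\<Prod>b\<in>B. [:- b, 1:])"
  shows "(\<Prod>b\<in>B. [:- b, 1:]) dvd g"
proof (rule prod_linear_dvd[OF fin])
  fix b assume b: "b \<in> B"
  have "poly (g * pderiv (\<Prod>b\<in>B. [:- b, 1:])) b = 0"
  proof -
    obtain r where "g * pderiv (\<Prod>b\<in>B. [:- b, 1:]) = (\<Prod>b\<in>B. [:- b, 1:]) * r"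
      using dvd by (rule dvdE)
    moreover have "poly (\<Prod>b\<in>B. [:- b, 1:]) b = 0"
      unfolding poly_prod_linear_eq_0[OF fin] by (rule b)
    ultimately show ?thesis by (metis poly_mult mult_zero_left)
  qed
  then show "poly g b = 0"
    using poly_pderiv_prod_linear_neq_0[OF fin b] by simp
qed

text \<open>Write \<open>p = h * r\<close> with \<open>h\<close> the product. On \<open>B\<close>
  the derivative of \<open>p\<close> equals \<open>pderiv h * r\<close>, and \<open>pderiv h\<close>
  has no zero there, so \<open>r\<close> vanishes on \<open>B\<close> as well.\<close>

lemma prod_linear_power2_dvd:
  fixes p :: "'a::field poly"
  assumes fin: "finite B" and "\<And>b. b \<in> B \<Longrightarrow> poly p b = 0"
    and d: "\<And>b. b \<in> B \<Longrightarrow> poly (pderiv p) b = 0"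
  shows "(\<Prod>b\<in>B. [:- b, 1:])\<^sup>2 dvd p"
proof -
  let ?h = "\<Prod>b\<in>B. [:- b, 1:]"
  have "?h dvd p" using assms by (intro prod_linear_dvd)
  then obtain r where r: "p = ?h * r" by blast
  have "poly r b = 0" if "b \<in> B" for b
    using d[OF that] poly_pderiv_prod_linear_neq_0[OF fin that]
      poly_prod_linear_eq_0[OF fin, of b] that
    unfolding r by (simp add: pderiv_mult)
  then have "?h dvd r" by (intro prod_linear_dvd fin)
  then show ?thesis unfolding r power2_eq_square by (intro mult_dvd_mono dvd_refl)
qed

lemma poly_eq_0_if_many_roots:
  fixes p :: "'a::field poly"
  assumes "\<And>b. b \<in> B \<Longrightarrow> poly p b = 0" and "degree p < card B"
  shows "p = 0"
proof (rule ccontr)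
  assume nz: "p \<noteq> 0"
  have "card B \<le> card {x. poly p x = 0}"
    using assms poly_roots_finite[OF nz] by (intro card_mono) auto
  also have "\<dots> \<le> degree p" by (rule card_poly_roots_bound[OF nz])
  finally show False using assms by simp
qed

lemma coeff_X_plus_1_power: "coeff ([:1, 1::'a::comm_ring_1:] ^ n) i = of_nat (n choose i)"
proof (cases "i \<le> n")
  case True
  then show ?thesis using coeff_linear_poly_power[of i n 1 1] by simp
next
  case False
  moreover have "degree ([:1, 1::'a:] ^ n) \<le> n"
    using degree_power_le[of "[:1, 1::'a:]" n] by simp
  ultimately show ?thesis by (simp add: coeff_eq_0 binomial_eq_0)
qed

section \<open>Subgroup and representations as sets of roots\<close>

text \<open>Every \<open>k\<close>-th power of a nonzero element is a \<open>t\<close>-th root of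
  unity, and there are at most \<open>t\<close> of these, so counting turns the inclusion into
  equality.\<close>

lemma power_subgroup_eq:
  assumes "k dvd CARD('a::finite_field) - 1" and "t = card (power_subgroup k :: 'a set)"
    and "t > 0"
  shows "(power_subgroup k :: 'a set) = {x. x ^ t = 1}" and "CARD('a) - 1 = k * t"
proof -
  have "t = (CARD('a) - 1) div k" using assms card_power_subgroup[where 'a = 'a] by simp
  then show m: "CARD('a) - 1 = k * t" using assms by simp
  have "(x ^ k) ^ t = 1" if "x \<noteq> 0" for x :: 'a
    using power_card_minus_one[OF that] unfolding m power_mult .
  then have "(power_subgroup k :: 'a set) \<subseteq> {x. x ^ t = 1}"
    unfolding power_subgroup_def by blast
  moreover have "card {x::'a. x ^ t = 1} \<le> card (power_subgroup k :: 'a set)"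
    using card_power_eq_le(2)[of t 1] assms by simp
  ultimately show "(power_subgroup k :: 'a set) = {x. x ^ t = 1}"
    by (intro card_seteq card_power_eq_le(1) assms)
qed

text \<open>Dividing a pair by \<open>d\<close> normalises its difference to 1; the pair is then
  determined by \<open>y / d\<close>.\<close>

lemma diff_rep_roots_of_unity:
  fixes d :: "'a::field"
  assumes "d \<noteq> 0"
  shows "diff_rep {x. x ^ t = 1} d = card {x. x ^ t = inverse d ^ t \<and> (x + 1) ^ t = inverse d ^ t}"
proof -
  have 1: "(y / d) ^ t = inverse d ^ t \<longleftrightarrow> y ^ t = 1" for y
    using assms by (simp add: power_divide field_simps)
  have 2: "(y / d + 1) ^ t = inverse d ^ t \<longleftrightarrow> (d + y) ^ t = 1" for y
  proof -
    have "y / d + 1 = (d + y) / d" using assms by (simp add: field_simps)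
    then show ?thesis using 1[of "d + y"] by simp
  qed
  have "bij_betw (\<lambda>(x, y). y / d) {(x, y) \<in> {x. x ^ t = 1} \<times> {x. x ^ t = 1}. x - y = d}
    {x. x ^ t = inverse d ^ t \<and> (x + 1) ^ t = inverse d ^ t}"
  proof (rule bij_betw_byWitness[where f' = "\<lambda>z. (z * d + d, z * d)"])
    show "(\<lambda>z. (z * d + d, z * d)) ` {x. x ^ t = inverse d ^ t \<and> (x + 1) ^ t = inverse d ^ t}
       \<subseteq> {(x, y) \<in> {x. x ^ t = 1} \<times> {x. x ^ t = 1}. x - y = d}"
    proof safe
      fix z assume z: "z ^ t = inverse d ^ t" "(z + 1) ^ t = inverse d ^ t"
      then have "((z + 1) * d) ^ t = 1" and "(z * d) ^ t = 1"
        using assms by (simp_all add: power_mult_distrib power_inverse)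
      then show "(z * d + d) ^ t = 1" "(z * d) ^ t = 1"
        by (simp_all add: distrib_right)
    qed auto
  qed (use assms in \<open>auto simp: 1 2 diff_eq_eq\<close>)
  then show ?thesis unfolding diff_rep_def by (rule bij_betw_same_card)
qed

section \<open>Equality outside characteristic 3: differential equations\<close>

lemma degree_pderiv_le: "degree (pderiv p) \<le> degree p - 1"
  by (rule degree_le) (auto simp: coeff_pderiv coeff_eq_0)

text \<open>In the application \<open>m = card B\<close> and \<open>t = 2 * m\<close>, so the
  exponent is \<open>2 * t + 1\<close>. Differential equations for \<open>h\<close> force
  \<open>4 * m + 1 = 0\<close> in the field, and the first-order equation that then remains turns
  into the shift identity.\<close>

lemma shift_identity_of_square:
  fixes h :: "'a::field poly" and c :: 'a
  assumes m: "m \<ge> 3" "of_nat m \<noteq> (0::'a)" and N0: "of_nat (2 * m + 1) \<noteq> (0::'a)"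
    and two: "(2::'a) \<noteq> 0" and three: "(3::'a) \<noteq> 0"
    and deg: "degree h = m" and cancel: "\<And>g. h dvd g * pderiv h \<Longrightarrow> h dvd g"
    and square: "of_nat (2 * m + 1) * h\<^sup>2 = [:1, 1:] ^ (2 * m + 1) - [:0, 1:] ^ (2 * m + 1) - [:c:]"
  shows "(x + 1) ^ (4 * m + 1) = x ^ (4 * m + 1) + c\<^sup>2"
proof -
  define X Y C M P Q where "X = [:0, 1::'a:]" and "Y = [:1, 1::'a:]" and "C = [:c:]"
    and "M = (of_nat m :: 'a poly)" and "P = Y ^ (2 * m)" and "Q = X ^ (2 * m)"
  define h1 h2 h3 where "h1 = pderiv h" and "h2 = pderiv h1" and "h3 = pderiv h2"
  have Y: "Y = X + 1" by (simp add: X_def Y_def one_pCons)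
  have dX: "pderiv X = 1" and dY: "pderiv Y = 1" and dC: "pderiv C = 0" and dM: "pderiv M = 0"
    by (simp_all add: X_def Y_def C_def M_def pderiv_pCons)
  have dnum: "pderiv (numeral w :: 'a poly) = 0" for w
    by (metis of_nat_numeral pderiv_of_nat)
  note d = pderiv_mult pderiv_add pderiv_diff pderiv_minus dX dY dC dM dnum
    h1_def[symmetric] h2_def[symmetric] h3_def[symmetric]
  have of_nat_0: "(of_nat w :: 'a poly) = 0 \<longleftrightarrow> (of_nat w :: 'a) = 0" for w
    by (simp add: of_nat_poly)
  have smult_of_nat: "smult (of_nat w) p = of_nat w * p" for w and p :: "'a poly"
    by (simp add: of_nat_poly)
  have two': "(2 :: 'a poly) \<noteq> 0" and three': "(3 :: 'a poly) \<noteq> 0"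
    using of_nat_0[of 2] of_nat_0[of 3] two three by simp_all
  have M0: "M \<noteq> 0" and N0': "2 * M + 1 \<noteq> 0"
    using of_nat_0[of m] of_nat_0[of "2 * m + 1"] m N0 by (simp_all add: M_def add.commute)
  have h0: "h \<noteq> 0" using deg m by auto
  have E0: "(2 * M + 1) * h\<^sup>2 = Y * P - X * Q - C"
    using square by (simp add: X_def Y_def C_def M_def P_def Q_def add.commute)
  have "(2 * M + 1) * (2 * h * h1) = pderiv ((2 * M + 1) * h\<^sup>2)"
    by (simp add: power2_eq_square d algebra_simps)
  also have "\<dots> = pderiv (Y ^ (2 * m + 1) - X ^ (2 * m + 1) - C)"
    unfolding E0 by (simp add: P_def Q_def)
  also have "\<dots> = (2 * M + 1) * (P - Q)"
    unfolding pderiv_diff pderiv_power dX dY dC smult_of_nat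
    by (simp add: P_def Q_def M_def algebra_simps)
  finally have E1: "2 * h * h1 = P - Q" using N0' by simp
  \<comment> \<open>Eliminating \<open>P\<close> leaves a power of \<open>X\<close> up to a
    constant, so the Euler relation \<open>XdQ\<close> yields the differential equation
    \<open>I\<close> for \<open>h\<close>.\<close>
  have E2: "(2 * M + 1) * h\<^sup>2 - 2 * Y * h * h1 = Q - C"
    using E0 E1 Y by algebra
  have XdQ: "X * pderiv Q = 2 * M * Q"
  proof -
    have "X * pderiv Q = of_nat (2 * m) * (X * X ^ (2 * m - 1))"
      unfolding Q_def pderiv_power dX smult_of_nat by (simp add: algebra_simps)
    also have "X * X ^ (2 * m - 1) = Q" unfolding Q_def using m by (simp add: power_eq_if)
    finally show ?thesis by (simp add: M_def)
  qed
  have "pderiv ((2 * M + 1) * h\<^sup>2 - 2 * Y * h * h1) = pderiv Q"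
    unfolding E2 by (simp add: d)
  then have "4 * M * h * h1 - 2 * Y * (h1\<^sup>2 + h * h2) = pderiv Q"
    by (simp add: power2_eq_square d algebra_simps)
  then have "X * (4 * M * h * h1 - 2 * Y * (h1\<^sup>2 + h * h2))
      = 2 * M * ((2 * M + 1) * h\<^sup>2 - 2 * Y * h * h1 + C)"
    using XdQ E2 by simp
  then have "2 * (X * Y * (h1\<^sup>2 + h * h2) - 2 * M * (X + Y) * h * h1
      + M * (2 * M + 1) * h\<^sup>2 + M * C) = 0"
    by algebra
  then have I: "X * Y * (h1\<^sup>2 + h * h2) - 2 * M * (X + Y) * h * h1
      + M * (2 * M + 1) * h\<^sup>2 + M * C = 0"
    using two' by (metis mult_eq_0_iff)
  \<comment> \<open>Differentiation removes the constant \<open>C\<close>. Every term without the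
    factor \<open>h\<close> then has the factor \<open>h1\<close>, so \<open>cancel\<close>
    applies.\<close>
  have "pderiv (X * Y * (h1\<^sup>2 + h * h2) - 2 * M * (X + Y) * h * h1
      + M * (2 * M + 1) * h\<^sup>2 + M * C) = 0"
    unfolding I by simp
  then have "(X + Y) * (h1\<^sup>2 + h * h2) + X * Y * (3 * h1 * h2 + h * h3) - 4 * M * h * h1
      - 2 * M * (X + Y) * (h1\<^sup>2 + h * h2) + 2 * M * (2 * M + 1) * h * h1 = 0"
    by (simp add: power2_eq_square d algebra_simps)
  then have "(3 * X * Y * h2 - (2 * M - 1) * (X + Y) * h1) * h1
      = h * (- ((X + Y) * h2 + X * Y * h3 - 4 * M * h1
      - 2 * M * (X + Y) * h2 + 2 * M * (2 * M + 1) * h1))"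
    by algebra
  then have "h dvd (3 * X * Y * h2 - (2 * M - 1) * (X + Y) * h1) * h1" (is "_ dvd ?G * _")
    by (rule dvdI)
  then have dvd: "h dvd ?G" unfolding h1_def by (rule cancel)
  have degc: "degree M = 0" "degree (numeral w :: 'a poly) = 0" for w
    by (simp_all add: M_def)
  have h1d: "degree h1 \<le> m - 1" and h2d: "degree h2 \<le> m - 2"
    using deg degree_pderiv_le[of h] degree_pderiv_le[of h1] unfolding h1_def h2_def by linarith+
  \<comment> \<open>The degree of \<open>?G\<close> is at most \<open>m = degree h\<close>, so the
    quotient is constant.\<close>
  obtain l where "?G = h * [:l:]"
  proof -
    have "degree (3 * X * Y * h2) \<le> 0 + 1 + 1 + (m - 2)"
      by (intro order.trans[OF degree_mult_le] add_mono h2d) (auto simp: degc X_def Y_def)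
    moreover have "degree ((2 * M - 1) * (X + Y) * h1) \<le> 0 + 1 + (m - 1)"
      by (intro order.trans[OF degree_mult_le] add_mono h1d degree_diff_le degree_add_le)
        (auto simp: degc X_def Y_def intro: order.trans[OF degree_mult_le])
    ultimately have "degree ?G \<le> m" using m by (intro degree_diff_le) auto
    moreover obtain k where k: "?G = h * k" using dvd by blast
    ultimately have "k = 0 \<or> degree k = 0"
      using h0 deg by (metis add_le_same_cancel1 degree_mult_eq le_zero_eq)
    then obtain l where "k = [:l:]" by (metis degree_0 degree_eq_zeroE)
    then show ?thesis using k that by blast
  qed
  define L where "L = [:l:]"
  have dL: "pderiv L = 0" by (simp add: L_def pderiv_pCons)
  have G: "3 * X * Y * h2 - (2 * M - 1) * (X + Y) * h1 = L * h"
    using \<open>?G = h * [:l:]\<close> by (simp add: L_def)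
  \<comment> \<open>Eliminating \<open>h2\<close> from \<open>3 * I\<close> by means of
    \<open>G\<close> gives the first-order equation \<open>II\<close>, with \<open>K\<close> as the
    coefficient of \<open>h\<^sup>2\<close>.\<close>
  define K where "K = L + 3 * M * (2 * M + 1)"
  have dK: "pderiv K = 0" by (simp add: K_def d dL)
  have II: "3 * X * Y * h1\<^sup>2 - (4 * M + 1) * (X + Y) * h * h1 + K * h\<^sup>2 + 3 * M * C = 0"
    using I G unfolding K_def by algebra
  have "pderiv (3 * X * Y * h1\<^sup>2 - (4 * M + 1) * (X + Y) * h * h1 + K * h\<^sup>2 + 3 * M * C) = 0"
    unfolding II by simp
  then have "3 * (X + Y) * h1\<^sup>2 + 6 * X * Y * h1 * h2
     - (4 * M + 1) * (2 * h * h1 + (X + Y) * (h1\<^sup>2 + h * h2)) + 2 * K * h * h1 = 0"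
    by (simp add: power2_eq_square d dK algebra_simps)
  then have "h * ((2 * L + 2 * K - 2 * (4 * M + 1)) * h1 - (4 * M + 1) * (X + Y) * h2) = 0"
    using G by algebra
  then have III: "(2 * L + 2 * K - 2 * (4 * M + 1)) * h1 = (4 * M + 1) * (X + Y) * h2"
    using h0 by simp
  have ch: "coeff h m \<noteq> 0" using deg h0 by auto
  have "coeff h1 (m - 1) = of_nat m * coeff h m"
    using m by (simp add: h1_def coeff_pderiv)
  then have h1_0: "h1 \<noteq> 0" using ch m by auto
  have four: "4 * M + 1 = 0"
    \<comment> \<open>otherwise \<open>h\<close>, of degree at least 3, divides the quadratic polynomial \<open>W\<close>\<close>
  proof (rule ccontr)
    assume ne: "4 * M + 1 \<noteq> 0"
    \<comment> \<open>Multiplying \<open>III\<close> by \<open>3 * X * Y\<close> and eliminating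
      \<open>h2\<close> by \<open>G\<close> makes \<open>W * h1\<close> a multiple of
      \<open>h\<close>.\<close>
    define W where "W = 3 * (2 * L + 2 * K - 2 * (4 * M + 1)) * X * Y
      - (4 * M + 1) * (2 * M - 1) * (X + Y)\<^sup>2"
    have "W * h1 = h * ((4 * M + 1) * (X + Y) * L)"
      using III G unfolding W_def by algebra
    then have "h dvd W * h1" by (rule dvdI)
    then have "h dvd W" unfolding h1_def by (rule cancel)
    moreover have "degree W \<le> 2"
    proof -
      have c: "degree a = 0 \<Longrightarrow> degree b \<le> n \<Longrightarrow> degree (a * b) \<le> n" for a b :: "'a poly" and n
        using degree_mult_le[of a b] by simp
      have cc: "degree a = 0 \<Longrightarrow> degree b = 0 \<Longrightarrow> degree (a * b) = 0"
        "degree a = 0 \<Longrightarrow> degree b = 0 \<Longrightarrow> degree (a + b) = 0"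
        "degree a = 0 \<Longrightarrow> degree b = 0 \<Longrightarrow> degree (a - b) = 0" for a b :: "'a poly"
        using degree_mult_le[of a b] degree_add_le[of a 0 b] degree_diff_le[of a 0 b] by auto
      have "degree (X * Y) \<le> 2" "degree ((X + Y)\<^sup>2) \<le> 2"
        by (auto simp: X_def Y_def power2_eq_square)
      moreover have "degree (3 * (2 * L + 2 * K - 2 * (4 * M + 1))) = 0"
        "degree ((4 * M + 1) * (2 * M - 1)) = 0"
        by (auto simp: degc L_def K_def intro!: cc)
      ultimately show ?thesis
        unfolding W_def mult.assoc[of _ X Y] using c degree_diff_le by blast
    qed
    ultimately have "W = 0"
      using deg m dvd_imp_degree_le[of h W] by auto
    \<comment> \<open>The constant coefficient leaves only \<open>2 * m = 1\<close> in the field.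
      Then \<open>III\<close> gives \<open>h2 = 0\<close>, whose top coefficient forces
      \<open>m = 1\<close>, a contradiction.\<close>
    then have "poly W 0 = 0" by simp
    moreover have "poly W 0 = - ((4 * of_nat m + 1) * (2 * of_nat m - 1))"
      by (simp add: W_def X_def Y_def M_def)
    ultimately have "(4 * of_nat m + 1 :: 'a) = 0 \<or> (2 * of_nat m - 1 :: 'a) = 0"
      by (metis mult_eq_0_iff neg_equal_0_iff_equal)
    moreover have "(4 * of_nat m + 1 :: 'a) \<noteq> 0"
      using ne of_nat_0[of "4 * m + 1"] by (simp add: M_def add.commute)
    ultimately have half: "2 * of_nat m = (1::'a)" by simp
    then have "(of_nat (2 * m) :: 'a poly) = 1"
      unfolding of_nat_poly[of "2 * m"] by (simp add: one_pCons)
    then have half': "2 * M = 1" by (simp add: M_def)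
    have "W = 3 * (2 * L + 2 * K - 2 * (4 * M + 1)) * (X * Y)"
      using half' unfolding W_def by algebra
    moreover have "X * Y \<noteq> 0" by (simp add: X_def Y_def)
    ultimately have "2 * L + 2 * K - 2 * (4 * M + 1) = 0"
      using \<open>W = 0\<close> three' by (metis mult_eq_0_iff)
    moreover have "X + Y \<noteq> 0" using two by (simp add: X_def Y_def)
    ultimately have "h2 = 0" using III ne by simp
    then have "coeff h2 (m - 2) = 0" by simp
    then have "of_nat (m - 1) * (of_nat m * coeff h m) = 0"
      using m by (simp add: h2_def h1_def coeff_pderiv numeral_2_eq_2 Suc_diff_Suc)
    then have "(of_nat (m - 1) :: 'a) = 0" using ch m by simp
    then have "(of_nat m :: 'a) = 1" using m by (simp add: of_nat_diff)
    then show False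
      using half by (metis add_cancel_right_right mult_1_right one_add_one zero_neq_one)
  qed
  then have "(2 * L + 2 * K - 2 * (4 * M + 1)) = 0" using III h1_0 by simp
  then have "2 * (L + K) = 0" using four by algebra
  then have "L + K = 0" using two' by (metis mult_eq_0_iff)
  then have K2: "2 * K = 3 * M * (2 * M + 1)" unfolding K_def by algebra
  \<comment> \<open>With \<open>4 * M = - 1\<close> the value of \<open>K\<close> is -3/16, and up
    to a nonzero factor \<open>II\<close> becomes
    \<open>16 * X * Y * h1\<^sup>2 = h\<^sup>2 + 4 * C\<close>.\<close>
  have K16: "16 * K + 3 = 0" using K2 four by algebra
  have "3 * (16 * X * Y * h1\<^sup>2 - h\<^sup>2 - 4 * C)
      = 16 * (3 * X * Y * h1\<^sup>2 - (4 * M + 1) * (X + Y) * h * h1 + K * h\<^sup>2 + 3 * M * C)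
        + (4 * M + 1) * (16 * (X + Y) * h * h1 - 12 * C) - (16 * K + 3) * h\<^sup>2"
    by (simp add: algebra_simps)
  also have "\<dots> = 0" unfolding II unfolding four K16 by simp
  finally have "3 * (16 * X * Y * h1\<^sup>2 - h\<^sup>2 - 4 * C) = 0" .
  then have "16 * X * Y * h1\<^sup>2 - h\<^sup>2 - 4 * C = 0"
    unfolding mult_eq_0_iff[of 3] using three' by blast
  then have "16 * X * Y * h1\<^sup>2 = h\<^sup>2 + 4 * C" by (simp add: algebra_simps)
  \<comment> \<open>After multiplication by \<open>h\<^sup>2\<close> only \<open>2 * h * h1\<close>
    and \<open>h\<^sup>2\<close> occur, and both are known in terms of \<open>P\<close> and
    \<open>Q\<close>.\<close>
  then have "4 * (X * Y * (2 * h * h1)\<^sup>2) = h\<^sup>2 * (h\<^sup>2 + 4 * C)"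
    by (simp add: power_mult_distrib mult_ac)
  moreover have "h\<^sup>2 = 2 * (Y * P - X * Q - C)"
  proof -
    have "(4 * M + 1) * h\<^sup>2 + h\<^sup>2 = 2 * ((2 * M + 1) * h\<^sup>2)" by (simp add: algebra_simps)
    then show ?thesis unfolding four E0 by simp
  qed
  ultimately have "4 * (X * Y * (P - Q)\<^sup>2)
      = 2 * (Y * P - X * Q - C) * (2 * (Y * P - X * Q - C) + 4 * C)"
    unfolding E1 by simp
  then have "4 * (Y * P\<^sup>2 - X * Q\<^sup>2 - C\<^sup>2) = 0"
    unfolding Y by (simp add: algebra_simps power2_eq_square)
  moreover have "(4 :: 'a poly) \<noteq> 0" using two' by (metis mult_eq_0_iff mult_2 numeral_Bit0)
  ultimately have "Y * P\<^sup>2 - X * Q\<^sup>2 - C\<^sup>2 = 0"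
    unfolding mult_eq_0_iff[of 4] by blast
  then have "Y * P\<^sup>2 = X * Q\<^sup>2 + C\<^sup>2" by (simp add: algebra_simps)
  then have "poly (Y * P\<^sup>2) x = poly (X * Q\<^sup>2 + C\<^sup>2) x" by simp
  then show ?thesis
    by (simp add: X_def Y_def C_def P_def Q_def add.commute flip: power_mult)
      (simp add: mult.commute distrib_right)
qed

section \<open>Equality in characteristic 3: ninth powers\<close>

lemma degree_X_plus_1_power_diff:
  "degree ([:1, 1::'a::comm_ring_1:] ^ n - [:0, 1:] ^ n) \<le> n - 1"
proof (rule degree_le, intro allI impI)
  fix i assume "n - 1 < i"
  then have "i \<ge> n" by simp
  moreover have "[:0, 1::'a:] ^ n = monom 1 n" by (simp add: monom_altdef)
  ultimately show "coeff ([:1, 1::'a:] ^ n - [:0, 1:] ^ n) i = 0"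
    by (cases "i = n") (simp_all add: coeff_X_plus_1_power binomial_eq_0)
qed

lemma power3_add:
  fixes x y :: "'a::comm_ring_1"
  assumes "(3 :: 'a) = 0"
  shows "(x + y) ^ 3 = x ^ 3 + y ^ 3"
proof -
  have "(x + y) ^ 3 = x ^ 3 + y ^ 3 + 3 * (x\<^sup>2 * y + x * y\<^sup>2)"
    by (simp add: power3_eq_cube power2_eq_square algebra_simps)
  then show ?thesis using assms by simp
qed

lemma power9_add:
  fixes x y :: "'a::comm_ring_1"
  assumes "(3 :: 'a) = 0"
  shows "(x + y) ^ 9 = x ^ 9 + y ^ 9"
proof -
  have "z ^ 9 = (z ^ 3) ^ 3" for z :: 'a by (simp flip: power_mult)
  then show ?thesis by (simp only: power3_add[OF assms])
qed

lemma inj_power9: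
  assumes three: "(3 :: 'a::idom) = 0"
  shows "inj (\<lambda>x::'a. x ^ 9)"
proof (rule injI)
  fix x y :: 'a
  assume eq: "x ^ 9 = y ^ 9"
  have "(x - y) ^ 9 = 0"
    using power9_add[OF three, of "x - y" y] eq by simp
  then show "x = y" by simp
qed

text \<open>The coefficient \<open>3 * X * Y\<close> of the differential equations vanishes here.
  Instead, relations satisfied by the elements of \<open>B\<close> become polynomial relations in
  their ninth powers, which hold identically when the degree is below \<open>card B\<close>. Only
  \<open>t mod 9 = 4\<close> yields the identity; the residues 1 and 7 are contradictory.\<close>

lemma shift_identity_char_3:
  fixes c :: "'a::field" and t :: nat
  defines "B \<equiv> {x. x ^ t = c \<and> (x + 1) ^ t = c}"
  assumes three: "(3 :: 'a) = 0" and t: "t \<ge> 5" "t mod 3 = 1" and c: "c \<noteq> 0"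
    and half: "2 * card B = t"
  shows "\<exists>e. \<forall>x::'a. (x + 1) ^ (2 * t + 1) = x ^ (2 * t + 1) + e"
proof -
  define X Y C where "X = [:0, 1::'a:]" and "Y = [:1, 1::'a:]" and "C = [:c:]"
  have degX: "degree (X ^ n) = n" and degY: "degree (Y ^ n) = n" for n
    by (simp_all add: X_def Y_def degree_power_eq)
  have degXY: "degree (Y ^ n - X ^ n) \<le> n - 1" for n
    unfolding X_def Y_def by (rule degree_X_plus_1_power_diff)
  have ev: "poly (X ^ n) x = x ^ n" "poly (Y ^ n) x = (x + 1) ^ n" "poly C x = c" for n x
    by (simp_all add: X_def Y_def C_def add.commute)
  have fin: "finite B" using half t by (metis card.infinite mult_0_right not_numeral_le_zero)
  have card: "card ((\<lambda>x. x ^ 9) ` B) = card B"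
    by (rule card_image) (rule inj_on_subset[OF inj_power9[OF three]], simp)
  \<comment> \<open>Since \<open>x ^ 9\<close> is injective, \<open>B\<close> provides
    \<open>t / 2\<close> distinct roots.\<close>
  have vanish: "p = 0"
    if "\<And>a. a \<in> B \<Longrightarrow> poly p (a ^ 9) = 0" and "2 * degree p < t" for p
  proof (rule poly_eq_0_if_many_roots)
    show "degree p < card ((\<lambda>x. x ^ 9) ` B)" using card half that(2) by simp
  qed (use that(1) in auto)
  have B: "a ^ t = c" "(a + 1) ^ t = c" if "a \<in> B" for a
    using that by (simp_all add: B_def)
  have nine: "(a ^ 9) ^ n = a ^ (9 * n)" "(a ^ 9 + 1) ^ n = (a + 1) ^ (9 * n)" for a :: 'a and n
    using power9_add[OF three, of a 1] by (simp_all add: power_mult)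
  have "t mod 9 = 1 \<or> t mod 9 = 4 \<or> t mod 9 = 7" using t(2) by presburger
  then consider (1) "t mod 9 = 1" | (4) "t mod 9 = 4" | (7) "t mod 9 = 7" by blast
  then show ?thesis
    \<comment> \<open>with \<open>b = a ^ 9\<close>, a small power of \<open>b\<close> equals, up to a constant, the inverse of \<open>a\<close>,
      \<open>a\<close> itself, or its square, and likewise for \<open>b + 1\<close> and \<open>a + 1\<close>\<close>
  proof cases
    case 1
    then obtain u where u: "t = 9 * u + 1" by (metis mult_div_mod_eq)
    \<comment> \<open>With \<open>b = a ^ 9\<close>, \<open>1 / a = b ^ u / c\<close> and likewise
      for \<open>a + 1\<close>; \<open>p\<close> clears denominators in
      \<open>1 / a - 1 / (a + 1) = 1 / (a * (a + 1))\<close>.\<close>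
    define p where "p = C * X ^ u - C * Y ^ u - X ^ u * Y ^ u"
    have degC: "degree (C * X ^ u - C * Y ^ u) \<le> u"
      using degX[of u] degY[of u] by (intro degree_diff_le) (simp_all add: C_def)
    have degXYu: "degree (X ^ u * Y ^ u) = 2 * u"
      using degX[of u] degY[of u] by (subst degree_mult_eq) (auto simp: X_def Y_def)
    have "p = 0"
    proof (rule vanish)
      fix a assume "a \<in> B"
      from B[OF this] have "c = a * a ^ (9 * u)" and c': "c = (a + 1) * (a + 1) ^ (9 * u)"
        by (simp_all add: u)
      then have "c * (a + 1) ^ (9 * u) = a * a ^ (9 * u) * (a + 1) ^ (9 * u)" by simp
      moreover have "c * a ^ (9 * u) = (a + 1) * (a + 1) ^ (9 * u) * a ^ (9 * u)"
        using c' by simp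
      ultimately show "poly p (a ^ 9) = 0"
        unfolding p_def poly_diff poly_mult ev nine by (simp only: algebra_simps) simp
    next
      have "degree p \<le> 2 * u"
        unfolding p_def by (rule degree_diff_le) (use degC degXYu in auto)
      then show "2 * degree p < t" using u by simp
    qed
    then have "2 * u \<le> u" using degC degXYu unfolding p_def by simp
    then show ?thesis using u t by simp
  next
    case 4
    then obtain u where u: "t = 9 * u + 4" by (metis mult_div_mod_eq)
    \<comment> \<open>Here \<open>b ^ (2 * u + 1) = c\<^sup>2 * a\<close> for
      \<open>b = a ^ 9\<close>, and likewise for \<open>a + 1\<close>; the difference is
      \<open>c\<^sup>2\<close>.\<close>
    define p where "p = Y ^ (2 * u + 1) - X ^ (2 * u + 1) - C\<^sup>2"
    have "p = 0"
    proof (rule vanish)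
      fix a assume a: "a \<in> B"
      have e: "9 * (2 * u + 1) = t + t + 1" by (simp add: u)
      from B[OF a] show "poly p (a ^ 9) = 0"
        unfolding p_def poly_diff poly_power[of C] ev nine unfolding e power_add
        by (simp add: power2_eq_square algebra_simps)
    next
      have "degree (C\<^sup>2) = 0" by (simp add: C_def power2_eq_square)
      moreover have "degree (Y ^ (2 * u + 1) - X ^ (2 * u + 1)) \<le> 2 * u"
        using degXY[of "2 * u + 1"] by (simp only: add_diff_cancel_right')
      ultimately have "degree p \<le> 2 * u"
        unfolding p_def by (intro degree_diff_le[of "Y ^ (2 * u + 1) - X ^ (2 * u + 1)"]) auto
      then show "2 * degree p < t" using u by simp
    qed
    \<comment> \<open>The ninth power of the identity \<open>p = 0\<close>, evaluated at
      \<open>x\<close>, has the required exponent.\<close>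
    have "(x + 1) ^ (2 * t + 1) = x ^ (2 * t + 1) + (c\<^sup>2) ^ 9" for x
    proof -
      have e: "2 * t + 1 = (2 * u + 1) * 9" by (simp add: u)
      have "poly p x = 0" using \<open>p = 0\<close> by simp
      then have "(x + 1) ^ (2 * u + 1) = x ^ (2 * u + 1) + c\<^sup>2"
        unfolding p_def poly_diff poly_power[of C] ev by (simp add: algebra_simps)
      then show ?thesis unfolding e power_mult by (simp only: power9_add[OF three])
    qed
    then show ?thesis by blast
  next
    case 7
    then obtain u where u: "t = 9 * u + 7" by (metis mult_div_mod_eq)
    define v where "v = u + 1"
    \<comment> \<open>\<open>G\<close> expresses \<open>(a + 1)\<^sup>2 - a\<^sup>2 - 1 = 2 * a\<close> in terms of \<open>a ^ 9\<close>\<close>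
    define G where "G = Y ^ v - X ^ v - C"
    have Ga: "poly G (a ^ 9) = 2 * c * a" if a: "a \<in> B" for a
    proof -
      have e: "9 * v = t + 2" by (simp add: u v_def)
      from B[OF a] show ?thesis
        unfolding G_def poly_diff ev nine e power_add
        by (simp add: power2_eq_square algebra_simps)
    qed
    have three': "(3 :: 'a poly) = 0" using three by (simp add: numeral_poly)
    \<comment> \<open>At \<open>a ^ 9\<close> the two terms are \<open>4 * (c * a)\<^sup>2\<close>
      and \<open>(c * a)\<^sup>2\<close>, equal because 3 vanishes.\<close>
    have "G\<^sup>2 - C * X ^ v = 0"
    proof (rule vanish)
      fix a assume a: "a \<in> B"
      have e: "9 * v = t + 2" by (simp add: u v_def)
      have "poly (G\<^sup>2 - C * X ^ v) (a ^ 9) = (2 * c * a)\<^sup>2 - c * (c * a\<^sup>2)"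
        unfolding poly_diff poly_power[of G] Ga[OF a] poly_mult ev nine e power_add B[OF a] ..
      also have "\<dots> = 3 * (c * a)\<^sup>2" by (simp add: power2_eq_square algebra_simps)
      finally show "poly (G\<^sup>2 - C * X ^ v) (a ^ 9) = 0" using three by simp
    next
      have "degree G \<le> v - 1"
        unfolding G_def by (intro degree_diff_le degXY) (simp add: C_def)
      then have "degree (G\<^sup>2) \<le> 2 * u"
        using degree_power_le[of G 2] by (simp add: v_def)
      moreover have "degree (C * X ^ v) \<le> v"
        using degX[of v] by (simp add: C_def)
      ultimately have "degree (G\<^sup>2 - C * X ^ v) \<le> max (2 * u) v"
        by (intro degree_diff_le) auto
      then show "2 * degree (G\<^sup>2 - C * X ^ v) < t" using u v_def by simp
    qed
    then have G2: "G\<^sup>2 = C * X ^ v" by simp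
    define j where "j = degree G"
    have "degree (G\<^sup>2) = v" unfolding G2 using c degX[of v] by (simp add: C_def)
    then have v: "v = 2 * j" by (cases "G = 0") (simp_all add: j_def degree_power_eq)
    have j: "j > 0" using v v_def by simp
    \<comment> \<open>Evaluating \<open>G\<^sup>2 = C * X ^ v\<close> at 1 exhibits
      \<open>poly G 1\<close> as a square root of \<open>c\<close>.\<close>
    define D where "D = [:poly G 1:]"
    have "poly (G\<^sup>2) 1 = c" unfolding G2 poly_mult ev by simp
    then have "D\<^sup>2 = C" by (simp add: D_def C_def power2_eq_square)
    then have "(G - D * X ^ j) * (G + D * X ^ j) = 0"
      using G2 unfolding v by (simp add: algebra_simps power_mult power2_eq_square power_mult_distrib)
    then obtain s where s: "G = [:s:] * X ^ j" and s2: "[:s:]\<^sup>2 = C"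
    proof -
      assume "(G - D * X ^ j) * (G + D * X ^ j) = 0"
      then have "G = [:poly G 1:] * X ^ j \<or> G = [:- poly G 1:] * X ^ j"
        by (auto simp: D_def eq_neg_iff_add_eq_0)
      moreover have "[:- poly G 1:]\<^sup>2 = C" "[:poly G 1:]\<^sup>2 = C"
        using \<open>D\<^sup>2 = C\<close> by (simp_all add: D_def power2_eq_square)
      ultimately show ?thesis using that by blast
    qed
    define E where "E = [:s:]"
    \<comment> \<open>The right side is \<open>(X ^ j - E)\<^sup>2\<close>, because
      \<open>- 2 = 1\<close> in characteristic 3.\<close>
    have "Y ^ v = X ^ v + E * X ^ j + E\<^sup>2"
      using s s2 unfolding G_def E_def by (simp add: algebra_simps)
    then have "(Y ^ j)\<^sup>2 = (X ^ j)\<^sup>2 + E * X ^ j + E\<^sup>2"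
      unfolding v by (simp add: power_mult mult.commute flip: power_mult)
    moreover have "(Y ^ j - (X ^ j - E)) * (Y ^ j + (X ^ j - E))
        = ((Y ^ j)\<^sup>2 - ((X ^ j)\<^sup>2 + E * X ^ j + E\<^sup>2)) + 3 * (E * X ^ j)"
      by (simp add: power2_eq_square algebra_simps)
    ultimately have "(Y ^ j - (X ^ j - E)) * (Y ^ j + (X ^ j - E)) = 0"
      using three' by simp
    moreover have "Y ^ j + (X ^ j - E) \<noteq> 0"
    proof -
      have "coeff (Y ^ j) j = 1" "coeff (X ^ j) j = 1" unfolding X_def Y_def by (rule coeff_linear_power)+
      moreover have "coeff E j = 0" using j by (simp add: E_def coeff_eq_0)
      moreover have "(2::'a) \<noteq> 0"
      proof
        assume "(2::'a) = 0"
        moreover have "(3::'a) = 2 + 1" by simp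
        ultimately show False using three by simp
      qed
      ultimately have "coeff (Y ^ j + (X ^ j - E)) j \<noteq> 0" by simp
      then show ?thesis by (metis coeff_0)
    qed
    ultimately have "Y ^ j - (X ^ j - E) = 0" unfolding mult_eq_0_iff by blast
    then have YX: "Y ^ j = X ^ j - E" by simp
    have shift: "(x + 1) ^ j = x ^ j - s" for x
      using arg_cong[OF YX, of "\<lambda>p. poly p x"] unfolding poly_diff ev by (simp add: E_def)
    have "1 = - s" using shift[of 0] j by (simp add: power_0_left)
    then have s1: "s = - 1" by (metis minus_minus)
    have "0 = (- 1) ^ j + (1 :: 'a)" using shift[of "-1"] j s1 by (simp add: power_0_left)
    then have minus: "(- 1) ^ j = (- 1 :: 'a)" by (metis eq_neg_iff_add_eq_0)
    have c1: "c = 1" using s2 s1 by (simp add: C_def power2_eq_square)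
    have e: "9 * j = Suc (9 * j - 1)" using j by simp
    have fixed: "a ^ (9 * j - 1) = 1" if a: "a \<in> B" for a
    proof -
      have "2 * a = - (a ^ (9 * j))"
        using Ga[OF a] c1 unfolding s poly_mult ev nine s1 by simp
      then have "a ^ (9 * j) = a - 3 * a" by (simp add: algebra_simps)
      then have "a * a ^ (9 * j - 1) = a" using three by (subst (asm) e) simp
      moreover have "a \<noteq> 0" using B[OF a] c t by (auto simp: power_0_left)
      ultimately show ?thesis by simp
    qed
    have "(- 1) ^ (9 * j) = (- 1 :: 'a)" unfolding mult.commute[of 9] power_mult minus by simp
    then have "(- 1 :: 'a) ^ (9 * j - 1) = 1" by (subst (asm) e) simp
    \<comment> \<open>Since \<open>t = 18 * j - 2\<close>, the set \<open>B\<close> already has the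
      maximal number \<open>9 * j - 1\<close> of roots, and -1 is one more.\<close>
    then have sub: "insert (- 1) B \<subseteq> {x. x ^ (9 * j - 1) = 1}" using fixed by blast
    have "- 1 \<notin> B" using c t by (auto simp: B_def power_0_left)
    then have "card B + 1 = card (insert (- 1) B)" using fin by simp
    also have "\<dots> \<le> card {x::'a. x ^ (9 * j - 1) = 1}"
      using j by (intro card_mono sub card_power_eq_le(1)) simp
    also have "\<dots> \<le> 9 * j - 1" using j by (intro card_power_eq_le(2)) simp
    finally show ?thesis using half u v v_def by simp
  qed
qed

section \<open>Stepanov bound and exclusion of equality\<close>

theorem corollary1p8:
  fixes p f q k t :: nat and d :: "'a::finite_field"
  assumes "prime p" and "f \<ge> 1" and "q = p ^ f" and "CARD('a) = q"
    and "k dvd q - 1"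
    and "generated_subfield (power_subgroup k :: 'a set) = UNIV"
    and "k \<ge> 3"
    and "t = card (power_subgroup k :: 'a set)" and "t \<ge> 5"
    and "d \<noteq> 0"
  shows "real (diff_rep (power_subgroup k) d) < real t / 2"
proof -
  let ?A = "power_subgroup k :: 'a set"
  have A: "?A = {x. x ^ t = 1}" and CARD: "CARD('a) - 1 = k * t"
    using power_subgroup_eq[where 'a = 'a, of k t] assms by simp_all
  define c where "c = inverse d ^ t"
  define B where "B = {x. x ^ t = c \<and> (x + 1) ^ t = c}"
  have c: "c \<noteq> 0" using assms by (simp add: c_def)
  have rep: "diff_rep ?A d = card B"
    unfolding A B_def c_def using assms by (intro diff_rep_roots_of_unity)
  \<comment> \<open>All \<open>k * t\<close> nonzero field elements would be roots of
    \<open>X ^ (j * t) - 1\<close>, although \<open>j < k\<close>. The value \<open>j = 1\<close>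
    serves for \<open>Q \<noteq> 0\<close> and \<open>j = 2\<close> for the equality case.\<close>
  have no_shift: False
    if j: "j \<le> 2" and shift: "\<And>x::'a. (x + 1) ^ (j * t + 1) = x ^ (j * t + 1) + e" and "j > 0" for j e
  proof -
    have "a ^ (j * t + 1) = a" if "a \<in> ?A" for a
      using that unfolding A by (simp add: mult.commute[of j] power_mult)
    then have "x ^ (j * t + 1) = x" for x :: 'a
      using power_fixed_everywhere[OF _ shift assms(6)] by simp
    then have "UNIV - {0} \<subseteq> {x::'a. x ^ (j * t) = 1}" by auto
    then have "card (UNIV - {0::'a}) \<le> card {x::'a. x ^ (j * t) = 1}"
      using assms \<open>j > 0\<close> by (intro card_mono card_power_eq_le(1)) auto
    also have "\<dots> \<le> j * t" using assms \<open>j > 0\<close> by (intro card_power_eq_le(2)) auto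
    also have "\<dots> < k * t" using j assms by simp
    also have "\<dots> = card (UNIV - {0::'a})" by (simp add: card_Diff_singleton flip: CARD)
    finally show False by simp
  qed
  \<comment> \<open>\<open>t\<close> divides \<open>CARD('a) - 1\<close>, which is -1 in the
    field.\<close>
  have t0: "(of_nat t :: 'a) \<noteq> 0"
  proof
    assume "(of_nat t :: 'a) = 0"
    then have "(of_nat (CARD('a) - 1) :: 'a) = 0" unfolding CARD by simp
    moreover have "of_nat CARD('a) = of_nat (CARD('a) - 1) + (1 :: 'a)"
      using zero_less_card_finite[where 'a = 'a] by (metis Suc_pred' of_nat_Suc add.commute)
    ultimately show False by (simp add: of_nat_CARD_eq_0)
  qed
  \<comment> \<open>\<open>Q = (X + 1) * ((X + 1) ^ t - c) - X * (X ^ t - c)\<close>, hence it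
    vanishes on \<open>B\<close>; its derivative is a multiple of \<open>(X + 1) ^ t - X ^ t\<close>
    and vanishes there too.\<close>
  define Q where "Q = [:1, 1:] ^ (t + 1) - [:0, 1:] ^ (t + 1) - [:c:]"
  define h where "h = (\<Prod>b\<in>B. [:- b, 1:])"
  have ev: "poly Q x = (x + 1) ^ (t + 1) - x ^ (t + 1) - c" for x
    by (simp add: Q_def add.commute distrib_right)
  have Q0: "Q \<noteq> 0"
  proof
    assume "Q = 0"
    then have "(x + 1) ^ (1 * t + 1) = x ^ (1 * t + 1) + c" for x
      using ev[of x] by (simp add: algebra_simps)
    then show False by (rule no_shift[rotated]) simp_all
  qed
  have dQ: "pderiv Q = of_nat (t + 1) * ([:1, 1:] ^ t - [:0, 1:] ^ t)"
    unfolding Q_def pderiv_diff pderiv_power by (simp add: pderiv_pCons of_nat_poly algebra_simps)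
  have "h\<^sup>2 dvd Q"
    unfolding h_def
  proof (rule prod_linear_power2_dvd)
    fix b assume "b \<in> B"
    then have b: "b ^ t = c" "(1 + b) ^ t = c" by (simp_all add: B_def add.commute)
    show "poly Q b = 0" unfolding ev using b by (simp add: algebra_simps)
    show "poly (pderiv Q) b = 0" unfolding dQ using b by simp
  qed simp
  then obtain r where r: "Q = h\<^sup>2 * r" by blast
  have degh: "degree h = card B" unfolding h_def by (rule degree_prod_linear)
  have lead: "lead_coeff h = 1" by (simp add: h_def lead_coeff_prod)
  have r0: "r \<noteq> 0" and h0: "h \<noteq> 0" using Q0 r by auto
  \<comment> \<open>The leading terms cancel, so the double zeros on \<open>B\<close> fit into
    degree at most \<open>t\<close>.\<close>
  have "degree ([:1, 1::'a:] ^ (t + 1) - [:0, 1:] ^ (t + 1)) \<le> t"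
    using degree_X_plus_1_power_diff[where 'a = 'a, of "t + 1"] by (simp only: add_diff_cancel_right')
  then have degQ: "degree Q \<le> t" unfolding Q_def by (rule degree_diff_le) simp
  have "degree Q = 2 * card B + degree r"
    unfolding r using r0 h0 by (simp add: degree_mult_eq degree_power_eq degh)
  then have le: "2 * card B \<le> t" and deg_r: "2 * card B = t \<Longrightarrow> degree r = 0"
    using degQ by auto
  have "2 * card B \<noteq> t"
  proof
    assume half: "2 * card B = t"
    obtain l where l: "r = [:l:]" using deg_r[OF half] by (metis degree_eq_zeroE)
    \<comment> \<open>As \<open>h\<close> is monic, the coefficient at \<open>t\<close> determines
      the constant cofactor; since that is nonzero, so is \<open>t + 1\<close> in the field.\<close>
    have "coeff Q t = of_nat (t + 1)"
    proof -
      have "[:0, 1::'a:] ^ (t + 1) = monom 1 (t + 1)" by (simp add: monom_altdef)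
      then show ?thesis
        unfolding Q_def coeff_diff coeff_X_plus_1_power using assms by (simp add: coeff_eq_0)
    qed
    moreover have "coeff (h\<^sup>2) t = 1"
      using lead degh half lead_coeff_power[of h 2] h0 by (simp add: degree_power_eq)
    ultimately have "l = of_nat (t + 1)" using r l by simp
    then have square: "of_nat (t + 1) * h\<^sup>2 = Q" and n0: "(of_nat (t + 1) :: 'a) \<noteq> 0"
      using r l r0 by (simp_all add: of_nat_poly)
    have "\<exists>e. \<forall>x::'a. (x + 1) ^ (2 * t + 1) = x ^ (2 * t + 1) + e"
    proof (cases "(3::'a) = 0")
      case True
      have mod3: "(of_nat n :: 'a) = of_nat (n mod 3)" for n
      proof -
        have "(of_nat n :: 'a) = of_nat (3 * (n div 3) + n mod 3)" by simp
        then show ?thesis unfolding of_nat_add of_nat_mult using True by simp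
      qed
      have "t mod 3 \<noteq> 0" using t0 mod3[of t] by (metis of_nat_0)
      moreover have "(t + 1) mod 3 \<noteq> 0" using n0 mod3[of "t + 1"] by (metis of_nat_0)
      ultimately have "t mod 3 = 1" by presburger
      then show ?thesis
        using True assms c half unfolding B_def by (intro shift_identity_char_3[of t c]) auto
    next
      case False
      \<comment> \<open>This also excludes characteristic 2.\<close>
      have nz: "(of_nat (2 * card B) :: 'a) \<noteq> 0" unfolding half by (rule t0)
      have "(x + 1) ^ (4 * card B + 1) = x ^ (4 * card B + 1) + c\<^sup>2" for x
      proof (rule shift_identity_of_square)
        show "card B \<ge> 3" using half assms by simp
        show "of_nat (card B) \<noteq> (0::'a)" "(2::'a) \<noteq> 0" using nz by auto
        show "of_nat (2 * card B + 1) \<noteq> (0::'a)" unfolding half by (rule n0)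
        show "of_nat (2 * card B + 1) * h\<^sup>2
            = [:1, 1:] ^ (2 * card B + 1) - [:0, 1:] ^ (2 * card B + 1) - [:c:]"
          unfolding half square by (rule Q_def)
        show "h dvd g" if "h dvd g * pderiv h" for g
          using that unfolding h_def by (rule prod_linear_dvd_mult_pderiv[rotated]) simp
      qed (use degh False in auto)
      moreover have "4 * card B + 1 = 2 * t + 1" using half by simp
      ultimately show ?thesis by metis
    qed
    then obtain e where "\<And>x::'a. (x + 1) ^ (2 * t + 1) = x ^ (2 * t + 1) + e" by blast
    then show False by (rule no_shift[rotated]) simp_all
  qed
  then have "2 * card B < t" using le by simp
  then show ?thesis unfolding rep by linarith
qed

end
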